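(* If $M$ is a noetherian gcd-monoid satisfying the $3$-Ore condition, then, for every $n$-multifraction $\underline a$ on $M$, one has $$\mathrm{red}(\underline a)=\underline a\bullet R^{\max}_{U(n)},$$ where $U(n)$ is the finite sequence of integers that is empty for $n\le1$ and, for $n\ge2$, is $(1,2,\dots,n-1)$ followed by $U(n-2)$.
   Context: For $a,b$ in a monoid $M$: $a$ left divides $b$ if $b=ax$ for some $x$ ($b$ is a right multiple of $a$); $a$ right divides $b$ if $b=xa$ for some $x$ ($b$ is a left multiple of $a$). A gcd-monoid is a cancellative monoid with no nontrivial invertible element in which any two elements admit a left gcd and a right gcd. In a gcd-monoid, two elements with a common right (resp. left) multiple have a unique right lcm $a\vee b$ (resp. left lcm $a\mathbin{\tilde\vee}b$). $M$ is noetherian if the proper left and proper right divisibility relations are both well-founded. $3$-Ore condition: any three elements of $M$ that pairwise admit a common right (resp. left) multiple admit a global common right (resp. left) multiple (both versions are required). An $n$-multifraction on $M$ is a sequence $\underline a=a_1/\cdots/a_n$ of $n$ elements of $M$. For $i\ge1$ and $x\in M$, one writes $\underline b=\underline a\bullet R_{i,x}$ if $\underline b$ has the same depth (length) as $\underline a$, this depth is $>i$, $b_k=a_k$ for $k\ne i-1,i,i+1$, and there is $x'\in M$ with: - $i$ even: $b_{i-1}=a_{i-1}x'$, $xb_i=a_ix'=x\vee a_i$, $xb_{i+1}=a_{i+1}$; - $i\ge3$ odd: $b_{i-1}=x'a_{i-1}$, $b_ix=x'a_i=x\mathbin{\tilde\vee}a_i$, $b_{i+1}x=a_{i+1}$;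 - $i=1$: $b_1x=a_1$, $b_2x=a_2$. One writes $\underline a\Rightarrow\underline b$ if $\underline b=\underline a\bullet R_{i,x}$ for some $i$ and some $x\ne1$. If $M$ is a noetherian gcd-monoid satisfying the $3$-Ore condition, this rewrite system is convergent, and $\mathrm{red}(\underline a)$ denotes the unique multifraction obtained from $\underline a$ by finitely many steps $\Rightarrow$ and to which no rule $R_{i,x}$ with $x\ne1$ applies. If $M$ is a noetherian gcd-monoid satisfying the $3$-Ore condition, then, for every $\underline a$ and every even (resp. odd) $i$ smaller than the depth of $\underline a$, there exists a (unique) element $x_{\max}\in M$ such that $\underline a\bullet R_{i,x}$ is defined if and only if $x$ left divides (resp. right divides) $x_{\max}$; one puts $\underline a\bullet R^{\max}_i:=\underline a\bullet R_{i,x_{\max}}$, and $\underline a\bullet R^{\max}_i:=\underline a$ for $i$ at least the depth of $\underline a$. For a sequence $\underline i=(i_1,\dots,i_\ell)$, $\underline a\bullet R^{\max}_{\underline i}:=(\cdots((\underline a\bullet R^{\max}_{i_1})\bullet R^{\max}_{i_2})\cdots)\bullet R^{\max}_{i_\ell}$. *)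

theory Defs
  imports Main
begin

context times
begin

definition left_dvd :: "'a \<Rightarrow> 'a \<Rightarrow> bool" where
  "left_dvd a b \<longleftrightarrow> (\<exists>x. b = a * x)"

definition right_dvd :: "'a \<Rightarrow> 'a \<Rightarrow> bool" where
  "right_dvd a b \<longleftrightarrow> (\<exists>x. b = x * a)"

definition is_left_gcd :: "'a \<Rightarrow> 'a \<Rightarrow> 'a \<Rightarrow> bool" where
  "is_left_gcd a b d \<longleftrightarrow>
     left_dvd d a \<and> left_dvd d b \<and> (\<forall>e. left_dvd e a \<and> left_dvd e b \<longrightarrow> left_dvd e d)"

definition is_right_gcd :: "'a \<Rightarrow> 'a \<Rightarrow> 'a \<Rightarrow> bool" where
  "is_right_gcd a b d \<longleftrightarrow>
     right_dvd d a \<and> right_dvd d b \<and> (\<forall>e. right_dvd e a \<and> right_dvd e b \<longrightarrow> right_dvd e d)"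

text \<open>Lcms exist only partially, so they are given as relations. A right lcm is a least
  common \<^emph>\<open>right\<close> multiple, hence least for \<^emph>\<open>left\<close> divisibility, and vice versa.\<close>

definition is_right_lcm :: "'a \<Rightarrow> 'a \<Rightarrow> 'a \<Rightarrow> bool" where
  "is_right_lcm a b m \<longleftrightarrow>
     left_dvd a m \<and> left_dvd b m \<and> (\<forall>c. left_dvd a c \<and> left_dvd b c \<longrightarrow> left_dvd m c)"

definition is_left_lcm :: "'a \<Rightarrow> 'a \<Rightarrow> 'a \<Rightarrow> bool" where
  "is_left_lcm a b m \<longleftrightarrow>
     right_dvd a m \<and> right_dvd b m \<and> (\<forall>c. right_dvd a c \<and> right_dvd b c \<longrightarrow> right_dvd m c)"

end

class gcd_monoid = monoid_mult +
  assumes left_cancel: "a * b = a * c \<Longrightarrow> b = c"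
    and right_cancel: "b * a = c * a \<Longrightarrow> b = c"
    and invertible_trivial: "a * b = 1 \<Longrightarrow> b * a = 1 \<Longrightarrow> a = 1"
    and left_gcd_exists: "\<exists>d. is_left_gcd a b d"
    and right_gcd_exists: "\<exists>d. is_right_gcd a b d"

definition noetherian :: "'a::gcd_monoid itself \<Rightarrow> bool" where
  "noetherian _ \<longleftrightarrow>
     wfp (\<lambda>a b :: 'a. left_dvd a b \<and> a \<noteq> b) \<and> wfp (\<lambda>a b :: 'a. right_dvd a b \<and> a \<noteq> b)"

definition common_right_multiple :: "'a::times set \<Rightarrow> bool" where
  "common_right_multiple A \<longleftrightarrow> (\<exists>m. \<forall>a\<in>A. left_dvd a m)"

definition common_left_multiple :: "'a::times set \<Rightarrow> bool" where
  "common_left_multiple A \<longleftrightarrow> (\<exists>m. \<forall>a\<in>A. right_dvd a m)"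

definition three_Ore :: "'a::gcd_monoid itself \<Rightarrow> bool" where
  "three_Ore _ \<longleftrightarrow>
     (\<forall>a b c :: 'a. common_right_multiple {a, b} \<and> common_right_multiple {b, c} \<and>
        common_right_multiple {a, c} \<longrightarrow> common_right_multiple {a, b, c}) \<and>
     (\<forall>a b c :: 'a. common_left_multiple {a, b} \<and> common_left_multiple {b, c} \<and>
        common_left_multiple {a, c} \<longrightarrow> common_left_multiple {a, b, c})"

type_synonym 'a multifraction = "'a list"

text \<open>Entries of a multifraction are numbered from 1.\<close>

definition entry :: "'a multifraction \<Rightarrow> nat \<Rightarrow> 'a" where
  "entry a k = a ! (k - 1)"

text \<open>\<open>R_step i x a b\<close> stands for $b = a \bullet R_{i,x}$, a partial operation on $a$.\<close>

definition R_step :: "nat \<Rightarrow> 'a::gcd_monoid \<Rightarrow> 'a multifraction \<Rightarrow> 'a multifraction \<Rightarrow> bool" where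
  "R_step i x a b \<longleftrightarrow>
     length b = length a \<and> 1 \<le> i \<and> i < length a \<and>
     (\<forall>k\<in>{1..length a} - {i - 1, i, i + 1}. entry b k = entry a k) \<and>
     (if i = 1 then
        entry b 1 * x = entry a 1 \<and> entry b 2 * x = entry a 2
      else if even i then
        (\<exists>x'. entry b (i - 1) = entry a (i - 1) * x' \<and>
              x * entry b i = entry a i * x' \<and> is_right_lcm x (entry a i) (entry a i * x') \<and>
              x * entry b (i + 1) = entry a (i + 1))
      else
        (\<exists>x'. entry b (i - 1) = x' * entry a (i - 1) \<and>
              entry b i * x = x' * entry a i \<and> is_left_lcm x (entry a i) (x' * entry a i) \<and>
              entry b (i + 1) * x = entry a (i + 1)))"

definition reduces :: "'a::gcd_monoid multifraction \<Rightarrow> 'a multifraction \<Rightarrow> bool" where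
  "reduces a b \<longleftrightarrow> (\<exists>i x. x \<noteq> 1 \<and> R_step i x a b)"

definition red :: "'a::gcd_monoid multifraction \<Rightarrow> 'a multifraction" where
  "red a = (THE b. reduces\<^sup>*\<^sup>* a b \<and> (\<nexists>c. reduces b c))"

definition x_max :: "nat \<Rightarrow> 'a::gcd_monoid multifraction \<Rightarrow> 'a" where
  "x_max i a =
     (THE z. \<forall>x. (\<exists>b. R_step i x a b) \<longleftrightarrow> (if even i then left_dvd x z else right_dvd x z))"

text \<open>Only indices \<open>i \<ge> 1\<close> are meaningful; the value at \<open>i = 0\<close> is irrelevant.\<close>

definition R_max :: "nat \<Rightarrow> 'a::gcd_monoid multifraction \<Rightarrow> 'a multifraction" where
  "R_max i a = (if i < length a then (THE b. R_step i (x_max i a) a b) else a)"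

definition R_max_seq :: "nat list \<Rightarrow> 'a::gcd_monoid multifraction \<Rightarrow> 'a multifraction" where
  "R_max_seq is a = foldl (\<lambda>b i. R_max i b) a is"

fun U :: "nat \<Rightarrow> nat list" where
  "U n = (if n \<le> 1 then [] else [1..<n] @ U (n - 2))"

declare U.simps [simp del]

end

(* A maximal R_i-step creates irreducibility at level i, and any R_i-step preserves it at level i - 1;
   it may only be lost at level i - 2. By the 3-Ore condition, if a is irreducible at levels
   i - 1 and i - 2, then an R_i-step followed by an R_(i-2)-step leads to irreducibility at level i - 1. Hence,
   if a is irreducible below level n - 1, then after the maximal R_(n-1)-step the maximal steps at
   levels n - 3, n - 5, ... suffice to reach the normal form, and entries n - 1 and n are not
   changed any more. The steps R_1, ..., R_(n-2) followed by U(n-3) normalize the entries up to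
   n - 1 by induction; as U(n-3) commutes with R_(n-1), the pass R_1, ..., R_(n-1) is followed by
   some reduction to normal form at levels below n - 2 only, and by confluence U(n-2) finds the
   same result. *)

theory Submission
  imports Defs
begin

text \<open>Uniqueness of normal forms is proved here, not presupposed, by Newman's lemma for the
  rules at levels below \<open>n\<close>. Two steps at one level meet in the maximal step of that
  level, and steps at distance at least 2 commute; only neighbouring levels form a genuine critical
  pair. The 3-Ore condition enters at two points. It makes the admissible reducers at one level
  closed under lcm, so that noetherianity yields a largest one. In the analysis of an
  \<open>R_i\<close>-step followed by an \<open>R_(i-2)\<close>-step it supplies one common multiple
  to which the irreducibility at both levels \<open>i - 1\<close> and \<open>i - 2\<close> can be
  applied. What a step can destroy is a matter of locality: reducibility at level \<open>i\<close>
  depends on entries \<open>i\<close> and \<open>i + 1\<close> only, while an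
  \<open>R_i\<close>-step multiplies entry \<open>i - 1\<close>, the very entry that level
  \<open>i - 2\<close> divides. Left and right divisibility alternate with the level, so the algebra
  is done for one abstract multiplication and instantiated with both orders.\<close>

text \<open>\<open>lcm_pair m a b x y\<close>: with respect to \<open>m\<close>, the right lcm of \<open>a\<close> and \<open>b\<close> is \<open>a x = b y\<close>. For the reversed
  multiplication this describes left lcms.\<close>

definition lcm_pair :: "('a \<Rightarrow> 'a \<Rightarrow> 'a) \<Rightarrow> 'a \<Rightarrow> 'a \<Rightarrow> 'a \<Rightarrow> 'a \<Rightarrow> bool" where
  "lcm_pair m a b x y \<longleftrightarrow> m a x = m b y \<and> (\<forall>s t. m a s = m b t \<longrightarrow> (\<exists>w. s = m x w))"

section \<open>Lcms, largest reducers and irreducibility in one orientation\<close>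

text \<open>Stated in one orientation so that both orders of multiplication are instances.
  \<open>wf_factor\<close> concerns right factors because these are what remains when a left factor
  is divided out, as happens to entry \<open>i + 1\<close> in a step.\<close>

locale ore_monoid =
  fixes m :: "'a \<Rightarrow> 'a \<Rightarrow> 'a" (infixl "\<odot>" 70) and e :: 'a
  assumes assoc: "a \<odot> b \<odot> c = a \<odot> (b \<odot> c)"
    and unit_left [simp]: "e \<odot> a = a"
    and unit_right [simp]: "a \<odot> e = a"
    and cancel_left [simp]: "a \<odot> b = a \<odot> c \<longleftrightarrow> b = c"
    and cancel_right [simp]: "b \<odot> a = c \<odot> a \<longleftrightarrow> b = c"
    and no_unit: "a \<odot> b = e \<Longrightarrow> a = e"
    and right_lcm: "a \<odot> u = b \<odot> v \<Longrightarrow> \<exists>x y. lcm_pair (\<odot>) a b x y"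
    and left_lcm: "u \<odot> a = v \<odot> b \<Longrightarrow> \<exists>x y. lcm_pair (\<lambda>x y. y \<odot> x) a b x y"
    and wf_factor: "wfp (\<lambda>a b. \<exists>x. x \<noteq> e \<and> b = x \<odot> a)"
    and ore: "\<lbrakk>a \<odot> u = b \<odot> v; b \<odot> u' = c \<odot> v'; a \<odot> u'' = c \<odot> v''\<rbrakk>
      \<Longrightarrow> \<exists>x y z. a \<odot> x = b \<odot> y \<and> a \<odot> x = c \<odot> z"
begin

lemma no_unit': "a \<odot> b = e \<Longrightarrow> b = e"
  using no_unit[of a b] by simp

lemma right_lcmE:
  assumes "a \<odot> u = b \<odot> v"
  obtains x y where "lcm_pair (\<odot>) a b x y" "a \<odot> x = b \<odot> y"
  using right_lcm[OF assms] unfolding lcm_pair_def by blast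

lemma left_lcmE:
  assumes "u \<odot> a = v \<odot> b"
  obtains x y where "lcm_pair (\<lambda>x y. y \<odot> x) a b x y" "x \<odot> a = y \<odot> b"
  using left_lcm[OF assms] unfolding lcm_pair_def by blast

lemma right_lcm_least:
  assumes "lcm_pair (\<odot>) a b x y" "a \<odot> s = b \<odot> t"
  obtains w where "s = x \<odot> w" "t = y \<odot> w"
proof -
  obtain w where w: "s = x \<odot> w" using assms unfolding lcm_pair_def by blast
  have "b \<odot> t = b \<odot> (y \<odot> w)"
    using assms w unfolding lcm_pair_def by (metis assoc)
  with w that show thesis by simp
qed

lemma left_lcm_least:
  assumes "lcm_pair (\<lambda>x y. y \<odot> x) a b x y" "s \<odot> a = t \<odot> b"
  obtains w where "s = w \<odot> x" "t = w \<odot> y"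
proof -
  obtain w where w: "s = w \<odot> x" using assms unfolding lcm_pair_def by blast
  have "t \<odot> b = w \<odot> y \<odot> b"
    using assms w unfolding lcm_pair_def by (metis assoc)
  with w that show thesis by simp
qed

text \<open>Cancelling a common outer factor \<open>d\<close> of the two cofactors would leave a
  smaller common multiple.\<close>

lemma left_lcm_coprime:
  assumes "lcm_pair (\<lambda>x y. y \<odot> x) a b (d \<odot> x) (d \<odot> y)"
  shows "d = e"
proof -
  have "x \<odot> a = y \<odot> b" using assms unfolding lcm_pair_def by (simp add: assoc)
  from left_lcm_least[OF assms this] obtain w where "x = w \<odot> (d \<odot> x)" by metis
  hence "e \<odot> x = (w \<odot> d) \<odot> x" by (simp add: assoc)
  hence "w \<odot> d = e" by (metis cancel_right)
  thus ?thesis by (rule no_unit')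
qed

lemma right_lcm_coprime:
  assumes "lcm_pair (\<odot>) a b (x \<odot> d) (y \<odot> d)"
  shows "d = e"
proof -
  have "a \<odot> x \<odot> d = b \<odot> y \<odot> d" using assms unfolding lcm_pair_def by (simp add: assoc)
  hence "a \<odot> x = b \<odot> y" by simp
  from right_lcm_least[OF assms this] obtain w where "x = x \<odot> d \<odot> w" by metis
  hence "x \<odot> e = x \<odot> (d \<odot> w)" by (simp add: assoc)
  hence "d \<odot> w = e" by (metis cancel_left)
  thus ?thesis by (rule no_unit)
qed

lemma right_lcm_unique:
  assumes "lcm_pair (\<odot>) a b x y" "lcm_pair (\<odot>) a b x' y'"
  shows "x = x'" "y = y'"
proof -
  obtain w where w: "x' = x \<odot> w" "y' = y \<odot> w"
    using right_lcm_least[OF assms(1)] assms(2) unfolding lcm_pair_def by metis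
  with assms(2) have "w = e" using right_lcm_coprime by metis
  with w show "x = x'" "y = y'" by auto
qed

text \<open>\<open>a\<close> and \<open>c\<close> play the entries \<open>i\<close> and
  \<open>i + 1\<close>; \<open>P\<close> stands for \<open>i = 1\<close>, where \<open>x\<close>
  must divide \<open>a\<close> itself. An admissible \<open>z\<close> with minimal cofactor in
  \<open>c\<close> absorbs every other admissible \<open>x\<close>, because the lcm of
  \<open>z\<close> and \<open>x\<close> is admissible again.\<close>

lemma max_divisor:
  "\<exists>z. \<forall>x. (\<exists>u. c = x \<odot> u) \<and> (\<exists>w v. (P \<longrightarrow> w = e) \<and> a \<odot> w = x \<odot> v) \<longleftrightarrow> (\<exists>u. z = x \<odot> u)"
proof -
  define D where "D x \<longleftrightarrow> (\<exists>w v. (P \<longrightarrow> w = e) \<and> a \<odot> w = x \<odot> v)" for x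
  have D_e: "D e" unfolding D_def by (rule exI[of _ e], rule exI[of _ a]) simp
  have "c \<in> {u. \<exists>x. D x \<and> c = x \<odot> u}"
    using D_e by (auto intro: exI[of _ e])
  from wf_factor[unfolded wfp_eq_minimal, rule_format, OF this] obtain u where
    u: "u \<in> {u. \<exists>x. D x \<and> c = x \<odot> u}"
    and min: "\<forall>u'. (\<exists>x. x \<noteq> e \<and> u = x \<odot> u') \<longrightarrow> u' \<notin> {u. \<exists>x. D x \<and> c = x \<odot> u}"
    by (rule bexE)
  then obtain z where z: "D z" "c = z \<odot> u" by blast
  have "(\<exists>u. c = x \<odot> u) \<and> D x \<longleftrightarrow> (\<exists>u. z = x \<odot> u)" for x
  proof
    assume "\<exists>u. z = x \<odot> u"
    then obtain t where t: "z = x \<odot> t" by blast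
    obtain w v where wv: "P \<longrightarrow> w = e" "a \<odot> w = z \<odot> v" using z(1) D_def by blast
    have "c = x \<odot> (t \<odot> u)" "a \<odot> w = x \<odot> (t \<odot> v)" using z(2) wv(2) t by (simp_all add: assoc)
    with wv(1) show "(\<exists>u. c = x \<odot> u) \<and> D x" unfolding D_def by blast
  next
    assume x: "(\<exists>u. c = x \<odot> u) \<and> D x"
    then obtain u1 where u1: "z \<odot> u = x \<odot> u1" using z by metis
    obtain s t where st: "lcm_pair (\<odot>) z x s t" "z \<odot> s = x \<odot> t"
      using right_lcmE[OF u1] .
    obtain u2 where u2: "u = s \<odot> u2" using right_lcm_least[OF st(1) u1] by metis
    obtain w v where wv: "P \<longrightarrow> w = e" "a \<odot> w = z \<odot> v" using z(1) D_def by blast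
    obtain w' v' where wv': "P \<longrightarrow> w' = e" "a \<odot> w' = x \<odot> v'" using x D_def by blast
    have "D (z \<odot> s)"
    proof (cases P)
      case True
      hence "z \<odot> v = x \<odot> v'" using wv wv' by simp
      then obtain r where "v = s \<odot> r" using right_lcm_least[OF st(1)] by metis
      hence "a \<odot> w = (z \<odot> s) \<odot> r" using wv(2) by (simp add: assoc)
      with wv(1) show ?thesis unfolding D_def by blast
    next
      case False
      \<comment> \<open>Any two of \<open>z\<close>, \<open>x\<close>, \<open>a\<close> have a
        common right multiple, \<open>z\<close> and \<open>x\<close> because both divide
        \<open>c\<close>.\<close>
      obtain n1 n2 n3 where n: "z \<odot> n1 = x \<odot> n2" "z \<odot> n1 = a \<odot> n3"
        using ore[OF u1 wv'(2)[symmetric] wv(2)[symmetric]] by metis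
      then obtain r where "n1 = s \<odot> r" using right_lcm_least[OF st(1)] by metis
      hence "a \<odot> n3 = (z \<odot> s) \<odot> r" using n(2) by (simp add: assoc)
      with False show ?thesis unfolding D_def by blast
    qed
    moreover have "c = z \<odot> s \<odot> u2" using z u2 by (simp add: assoc)
    \<comment> \<open>Otherwise \<open>u2\<close> would be a proper right factor of \<open>u\<close>
      and still the cofactor of an admissible element.\<close>
    ultimately have "s = e" using min u2 by blast
    thus "\<exists>u. z = x \<odot> u" using st(2) by auto
  qed
  thus ?thesis unfolding D_def by blast
qed

text \<open>\<open>a0\<close>, \<open>a\<close> are the entries \<open>i - 1\<close>,
  \<open>i\<close> before an \<open>R_i\<close>-step, and \<open>P\<close> stands for
  \<open>i = 2\<close>; level \<open>i - 1\<close> reads the multiplication reversed. The part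
  \<open>s\<close> of a new reducer \<open>y\<close> that is not covered by \<open>x'\<close> would
  have reduced the old entries, so \<open>y\<close> right divides \<open>x'\<close> and also
  \<open>b\<close>; but cofactors of an lcm are coprime.\<close>

lemma preserve_irreducible:
  assumes irr: "\<And>y u w v. \<lbrakk>a = u \<odot> y; P \<longrightarrow> w = e; w \<odot> a0 = v \<odot> y\<rbrakk> \<Longrightarrow> y = e"
    and lcm: "lcm_pair (\<odot>) a x x' b"
    and y: "b = u \<odot> y" "P \<longrightarrow> w = e" "w \<odot> (a0 \<odot> x') = v \<odot> y"
  shows "y = e"
proof -
  have "(w \<odot> a0) \<odot> x' = v \<odot> y" using y by (simp add: assoc)
  from left_lcmE[OF this] obtain s t where
    st: "lcm_pair (\<lambda>x y. y \<odot> x) x' y s t" "s \<odot> x' = t \<odot> y" .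
  have "a \<odot> x' = (x \<odot> u) \<odot> y" using lcm y unfolding lcm_pair_def by (simp add: assoc)
  then obtain w1 where w1: "a = w1 \<odot> s" using left_lcm_least[OF st(1)] by metis
  obtain w2 where w2: "w \<odot> a0 = w2 \<odot> s"
    using left_lcm_least[OF st(1) \<open>(w \<odot> a0) \<odot> x' = v \<odot> y\<close>] by metis
  have "s = e" using irr[OF w1 y(2) w2] .
  hence "lcm_pair (\<odot>) a x (t \<odot> y) (u \<odot> y)" using st lcm y by simp
  thus ?thesis by (rule right_lcm_coprime)
qed

text \<open>\<open>p, q, r\<close> are the entries at levels \<open>i - 2, i - 1, i\<close>; the \<open>R\<^sub>i\<close>-step replaces \<open>q, r\<close> by \<open>x' q, r1\<close>,
  and then the \<open>R\<^bsub>i-2\<^esub>\<close>-step with \<open>z\<close> replaces \<open>x' q\<close> by \<open>q1\<close>.\<close>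

lemma double_step_irreducible:
  assumes irr1: "\<And>y u w v. \<lbrakk>q = u \<odot> y; P \<longrightarrow> w = e; w \<odot> p = v \<odot> y\<rbrakk> \<Longrightarrow> y = e"
    and irr2: "\<And>y u w v. \<lbrakk>r = y \<odot> u; q \<odot> w = y \<odot> v\<rbrakk> \<Longrightarrow> y = e"
    and lcm: "lcm_pair (\<lambda>x y. y \<odot> x) r x x' r1"
    and z: "x' \<odot> q = q1 \<odot> z" "P \<longrightarrow> w = e" "w \<odot> p = v \<odot> z"
    and y: "r1 = y \<odot> d" "q1 \<odot> w' = y \<odot> v'"
  shows "y = e"
proof -
  obtain u v where uv: "lcm_pair (\<lambda>x y. y \<odot> x) q z u v" "u \<odot> q = v \<odot> z"
    using left_lcmE[OF z(1)] .
  obtain t where t: "x' = t \<odot> u" "q1 = t \<odot> v" using left_lcm_least[OF uv(1) z(1)] .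
  have x'r: "x' \<odot> r = r1 \<odot> x" using lcm unfolding lcm_pair_def by simp
  have 1: "t \<odot> (u \<odot> r) = y \<odot> (d \<odot> x)" using x'r t y by (simp add: assoc)
  \<comment> \<open>\<open>s\<close> is what \<open>t\<close> lacks to be a multiple of
    \<open>y\<close>. It left divides both \<open>u \<odot> r\<close> and
    \<open>v \<odot> w'\<close>, so \<open>u\<close>, \<open>v\<close>, \<open>s\<close> pairwise
    have common right multiples.\<close>
  obtain s y' where s: "lcm_pair (\<odot>) t y s y'" "t \<odot> s = y \<odot> y'" using right_lcmE[OF 1] .
  obtain s1 where s1: "u \<odot> r = s \<odot> s1" using right_lcm_least[OF s(1) 1] by metis
  have "t \<odot> (v \<odot> w') = y \<odot> v'" using y t by (simp add: assoc)
  from right_lcm_least[OF s(1) this] obtain s2 where s2: "v \<odot> w' = s \<odot> s2" by metis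
  obtain n1 n2 n3 where n: "u \<odot> n1 = v \<odot> n2" "u \<odot> n1 = s \<odot> n3"
    using ore[OF uv(2) s2 s1] by metis
  \<comment> \<open>Irreducibility at level \<open>i - 2\<close> makes \<open>u \<odot> q\<close>
    the right lcm of \<open>u\<close> and \<open>v\<close>: a common right factor \<open>g\<close>
    of \<open>q\<close> and \<open>z\<close> would be a reducer there.\<close>
  obtain q' z' where qz: "lcm_pair (\<odot>) u v q' z'" "u \<odot> q' = v \<odot> z'" using right_lcmE[OF n(1)] .
  obtain g where g: "q = q' \<odot> g" "z = z' \<odot> g" using right_lcm_least[OF qz(1) uv(2)] .
  have "w \<odot> p = (v2 \<odot> z') \<odot> g" if "w \<odot> p = v2 \<odot> z" for v2 using that g by (simp add: assoc)
  hence "g = e" using irr1[OF g(1) z(2)] z(3) by metis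
  with g have "q' = q" by simp
  with right_lcm_least[OF qz(1) n(1)] obtain n' where n': "n1 = q \<odot> n'" by metis
  \<comment> \<open>\<open>t'\<close> is what \<open>u\<close> lacks to be a multiple of
    \<open>s\<close>. It left divides \<open>r\<close> and the right multiple \<open>n1\<close> of
    \<open>q\<close>, so irreducibility at level \<open>i - 1\<close> makes it trivial.\<close>
  obtain t' t2 where t': "lcm_pair (\<odot>) u s t' t2" "u \<odot> t' = s \<odot> t2" using right_lcmE[OF s1] .
  obtain k where k: "r = t' \<odot> k" using right_lcm_least[OF t'(1) s1] by metis
  obtain k' where k': "n1 = t' \<odot> k'" using right_lcm_least[OF t'(1) n(2)] by metis
  have "q \<odot> n' = t' \<odot> k'" using n' k' by simp
  hence "t' = e" using irr2[OF k] by metis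
  hence "x' = y \<odot> (y' \<odot> t2)" using t t' s by (metis assoc unit_right)
  \<comment> \<open>\<open>y\<close> now left divides both cofactors \<open>x'\<close> and
    \<open>r1\<close> of a left lcm.\<close>
  thus ?thesis using lcm y left_lcm_coprime by metis
qed

text \<open>The overlap of an \<open>R\<^bsub>i,x\<^esub>\<close>-step with an \<open>R\<^bsub>i+1,y\<^esub>\<close>-step, where \<open>a, b\<close> are the entries \<open>i, i + 1\<close>. After
  \<open>R\<^bsub>i,x\<^esub> R\<^bsub>i+1,y\<^esub>\<close> one has the entries \<open>y'' a1, d\<close>, and after \<open>R\<^bsub>i+1,y\<^esub> R\<^bsub>i,s\<^esub>\<close> the entries \<open>h, d\<close>; an
  \<open>R\<^bsub>i-1,x1\<^esub>\<close>-step leads from the former to the latter.\<close>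

lemma overlap:
  assumes x: "lcm_pair (\<odot>) a x x' a1" "x \<odot> b1 = b"
    and y: "lcm_pair (\<lambda>x y. y \<odot> x) b y y' c2"
  obtains y'' d s t h x1 where
    "lcm_pair (\<lambda>x y. y \<odot> x) b1 y y'' d"
    "s \<odot> d = c2"
    "lcm_pair (\<odot>) (y' \<odot> a) s t h"
    "x' = t \<odot> x1" "y'' \<odot> a1 = h \<odot> x1"
proof -
  have ax: "a \<odot> x' = x \<odot> a1" and by': "y' \<odot> b = c2 \<odot> y"
    using x y unfolding lcm_pair_def by auto
  \<comment> \<open>The left lcm of \<open>b\<close> and \<open>y\<close> is also a common left
    multiple of \<open>b1\<close> and \<open>y\<close>, hence lies over their lcm; the quotient
    \<open>s\<close> is what remains of \<open>x\<close> after the step with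
    \<open>y\<close>.\<close>
  have 1: "(y' \<odot> x) \<odot> b1 = c2 \<odot> y" using by' x(2) by (simp add: assoc)
  obtain y'' d where yd: "lcm_pair (\<lambda>x y. y \<odot> x) b1 y y'' d" using left_lcm[OF 1] by metis
  obtain s where s: "y' \<odot> x = s \<odot> y''" "c2 = s \<odot> d" using left_lcm_least[OF yd 1] .
  have 2: "(y' \<odot> a) \<odot> x' = s \<odot> (y'' \<odot> a1)" using ax s by (metis assoc)
  obtain t h where th: "lcm_pair (\<odot>) (y' \<odot> a) s t h" using right_lcm[OF 2] by metis
  obtain x1 where "x' = t \<odot> x1" "y'' \<odot> a1 = h \<odot> x1" using right_lcm_least[OF th 2] .
  with yd s(2) th that show thesis by metis
qed

text \<open>Two lcm squares are pasted along their common side \<open>b\<close>; this turns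
  successive steps at one level into a single step.\<close>

lemma lcm_compose:
  assumes 1: "lcm_pair (\<odot>) a x x' b" and 2: "lcm_pair (\<odot>) b y y' c"
  shows "lcm_pair (\<odot>) a (x \<odot> y) (x' \<odot> y') c"
  unfolding lcm_pair_def
proof safe
  show "a \<odot> (x' \<odot> y') = x \<odot> y \<odot> c"
    using 1 2 unfolding lcm_pair_def by (metis assoc)
  fix s t assume "a \<odot> s = x \<odot> y \<odot> t"
  hence "a \<odot> s = x \<odot> (y \<odot> t)" by (simp add: assoc)
  then obtain w where w: "s = x' \<odot> w" "y \<odot> t = b \<odot> w" using right_lcm_least[OF 1] by metis
  then obtain w' where "w = y' \<odot> w'" using right_lcm_least[OF 2] by metis
  thus "\<exists>w. s = x' \<odot> y' \<odot> w" using w by (metis assoc)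
qed

end


section \<open>Both orientations of a gcd-monoid\<close>

context gcd_monoid
begin

text \<open>A common multiple that is minimal for divisibility is least: its left gcd with any other
  common multiple is again a common multiple.\<close>

lemma right_lcm_pair:
  assumes wf: "wfp (\<lambda>a b. left_dvd a b \<and> a \<noteq> b)" and "a * u = b * v"
  shows "\<exists>x y. lcm_pair (*) a b x y"
proof -
  have "a * u \<in> {c. left_dvd a c \<and> left_dvd b c}"
    using assms(2) unfolding left_dvd_def by blast
  then obtain c where c: "left_dvd a c" "left_dvd b c"
    and min: "\<And>d. left_dvd d c \<and> d \<noteq> c \<Longrightarrow> d \<notin> {c. left_dvd a c \<and> left_dvd b c}"
    using wf[unfolded wfp_eq_minimal] by (metis (lifting) mem_Collect_eq)
  obtain x y where xy: "c = a * x" "c = b * y" using c unfolding left_dvd_def by blast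
  have "\<exists>w. s = x * w" if st: "a * s = b * t" for s t
  proof -
    obtain d where d: "is_left_gcd c (a * s) d" using left_gcd_exists by blast
    have "left_dvd a (a * s)" "left_dvd b (a * s)" using st unfolding left_dvd_def by blast+
    hence "left_dvd a d" "left_dvd b d" "left_dvd d c" "left_dvd d (a * s)"
      using d c unfolding is_left_gcd_def by auto
    hence "left_dvd c (a * s)" using min[of d] by auto
    then obtain w where "a * s = a * (x * w)"
      unfolding left_dvd_def xy(1) by (auto simp: mult.assoc)
    thus ?thesis using left_cancel by blast
  qed
  thus ?thesis using xy unfolding lcm_pair_def by metis
qed

end

text \<open>With \<open>p\<close> the parity of the level, \<open>mul p\<close> turns the even and the odd reduction rules into one;
  passing to a neighbouring level reverses the multiplication.\<close>

definition mul :: "bool \<Rightarrow> 'a::times \<Rightarrow> 'a \<Rightarrow> 'a" where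
  "mul p a b = (if p then a * b else b * a)"

lemma mul_flip: "mul (\<not> p) a b = mul p b a"
  by (simp add: mul_def)

lemma lcm_pair_flip: "lcm_pair (mul (\<not> p)) = lcm_pair (\<lambda>x y. mul p y x)"
  by (simp add: mul_flip[abs_def])

lemma mul_simps:
  "mul True = (*)" "mul False = (\<lambda>x y. y * x)"
  by (simp_all add: mul_def fun_eq_iff)

lemma left_dvd_mul:
  "times.left_dvd (mul True) = left_dvd" "times.left_dvd (mul False) = right_dvd"
  by (simp_all add: mul_simps times.left_dvd_def left_dvd_def right_dvd_def fun_eq_iff)

lemma gcd_monoid_mul: "class.gcd_monoid (1 :: 'a::gcd_monoid) (mul p)"
proof (cases p)
  case True
  thus ?thesis by (simp add: mul_simps gcd_monoid_axioms)
next
  case False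
  have "class.gcd_monoid (1 :: 'a) (\<lambda>x y. y * x)"
    apply unfold_locales
    subgoal by (simp add: mult.assoc)
    subgoal by simp
    subgoal by simp
    subgoal by (rule right_cancel)
    subgoal by (rule left_cancel)
    subgoal by (rule invertible_trivial)
    subgoal for a b using right_gcd_exists[of a b]
      by (simp add: times.is_left_gcd_def is_right_gcd_def times.left_dvd_def right_dvd_def)
    subgoal for a b using left_gcd_exists[of a b]
      by (simp add: times.is_right_gcd_def is_left_gcd_def times.right_dvd_def left_dvd_def)
    done
  thus ?thesis using False by (simp add: mul_simps)
qed

lemma ore_monoid_mul:
  assumes noeth: "noetherian TYPE('a::gcd_monoid)" and ore: "three_Ore TYPE('a)"
  shows "ore_monoid (mul p) (1 :: 'a)"
proof -
  have wf: "wfp (\<lambda>a b :: 'a. times.left_dvd (mul q) a b \<and> a \<noteq> b)" for q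
    using noeth by (cases q) (auto simp: noetherian_def left_dvd_mul)
  have lcm: "\<exists>x y. lcm_pair (mul q) a b x y" if "mul q a u = mul q b v" for q and a b u v :: 'a
    using gcd_monoid.right_lcm_pair[OF gcd_monoid_mul wf that] .
  have cancel: "mul q a b = mul q a c \<longleftrightarrow> b = c" for q and a b c :: 'a
    using left_cancel right_cancel by (auto simp: mul_def)
  have assoc: "mul q (mul q a b) c = mul q a (mul q b c)" for q and a b c :: 'a
    by (simp add: mul_def mult.assoc)
  have one: "mul q 1 a = a" "mul q a 1 = a" for q and a :: 'a
    by (simp_all add: mul_def)
  have common: "\<exists>x y z. mul q a x = mul q b y \<and> mul q a x = mul q c z"
    if "mul q a u = mul q b v" "mul q b u' = mul q c v'" "mul q a u'' = mul q c v''"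
    for q and a b c u v u' v' u'' v'' :: 'a
  proof (cases q)
    case True
    have "common_right_multiple {a, b}" "common_right_multiple {b, c}" "common_right_multiple {a, c}"
      using that True unfolding common_right_multiple_def left_dvd_def mul_def
      by (simp; metis)+
    hence "common_right_multiple {a, b, c}" using ore unfolding three_Ore_def by blast
    then obtain n where "left_dvd a n" "left_dvd b n" "left_dvd c n"
      unfolding common_right_multiple_def by blast
    then obtain x y z where "n = a * x" "n = b * y" "n = c * z" unfolding left_dvd_def by blast
    thus ?thesis using True by (metis mul_def)
  next
    case False
    have "common_left_multiple {a, b}" "common_left_multiple {b, c}" "common_left_multiple {a, c}"
      using that False unfolding common_left_multiple_def right_dvd_def mul_def
      by (simp; metis)+
    hence "common_left_multiple {a, b, c}" using ore unfolding three_Ore_def by blast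
    then obtain n where "right_dvd a n" "right_dvd b n" "right_dvd c n"
      unfolding common_left_multiple_def by blast
    then obtain x y z where "n = x * a" "n = y * b" "n = z * c" unfolding right_dvd_def by blast
    thus ?thesis using False by (metis mul_def)
  qed
  \<comment> \<open>\<open>invertible_trivial\<close> asks for a two-sided inverse; cancellation
    supplies the missing side.\<close>
  have no_unit: "a = 1" if "mul q a b = 1" for q and a b :: 'a
  proof -
    have "mul q (mul q b a) b = mul q 1 b" by (simp only: assoc that one)
    hence "mul (\<not> q) b (mul q b a) = mul (\<not> q) b 1" by (simp only: mul_flip)
    hence "mul q b a = 1" using cancel by blast
    thus ?thesis using that invertible_trivial[of a b] invertible_trivial[of b a]
      by (cases q) (simp_all add: mul_simps)
  qed
  show ?thesis
  proof
    \<comment> \<open>Right factors for \<open>mul p\<close> are left divisors for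
      \<open>mul (\<not> p)\<close>, and a nontrivial cofactor makes them proper.\<close>
    show "wfp (\<lambda>a b :: 'a. \<exists>x. x \<noteq> 1 \<and> b = mul p x a)"
      unfolding wfp_iff_ex_minimal
    proof (intro allI impI)
      fix B :: "'a set" assume "B \<noteq> {}"
      then obtain z where z: "z \<in> B" "\<And>y. times.left_dvd (mul (\<not> p)) y z \<and> y \<noteq> z \<Longrightarrow> y \<notin> B"
        using wf[of "\<not> p", unfolded wfp_iff_ex_minimal] by blast
      have "times.left_dvd (mul (\<not> p)) y z \<and> y \<noteq> z" if "x \<noteq> 1" "z = mul p x y" for x y
      proof
        show "times.left_dvd (mul (\<not> p)) y z"
          using that by (auto simp: times.left_dvd_def mul_flip)
        show "y \<noteq> z"
        proof
          assume "y = z"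
          hence "mul p x y = y" using that(2) by metis
          hence "mul (\<not> p) y x = mul (\<not> p) y 1" by (simp only: mul_flip one)
          thus False using cancel that(1) by blast
        qed
      qed
      thus "\<exists>z\<in>B. \<forall>y. (\<exists>x. x \<noteq> 1 \<and> z = mul p x y) \<longrightarrow> y \<notin> B" using z by blast
    qed
  next
    fix a b c :: 'a
    show "mul p (mul p a b) c = mul p a (mul p b c)" by (rule assoc)
    show "mul p 1 a = a" "mul p a 1 = a" by (rule one)+
    show "mul p a b = mul p a c \<longleftrightarrow> b = c" by (rule cancel)
    show "mul p b a = mul p c a \<longleftrightarrow> b = c" using cancel[of "\<not> p"] by (simp add: mul_flip)
    show "mul p a b = 1 \<Longrightarrow> a = 1" by (rule no_unit)
    show "mul p a u = mul p b v \<Longrightarrow> \<exists>x y. lcm_pair (mul p) a b x y" for u v by (rule lcm)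
    show "mul p u a = mul p v b \<Longrightarrow> \<exists>x y. lcm_pair (\<lambda>x y. mul p y x) a b x y" for u v
      using lcm[of "\<not> p" a u b v] by (simp only: mul_flip lcm_pair_flip)
    show "mul p a u = mul p b v \<Longrightarrow> mul p b u' = mul p c v' \<Longrightarrow> mul p a u'' = mul p c v'' \<Longrightarrow>
      \<exists>x y z. mul p a x = mul p b y \<and> mul p a x = mul p c z" for u v u' v' u'' v''
      by (rule common)
  qed
qed


section \<open>Multifractions as functions; steps at a single level\<close>

text \<open>An $n$-multifraction is treated as a function with value 1 outside \<open>{1..n}\<close>. Then prefixes need
  no truncation, and rule 1 becomes an instance of the odd rule, with the factor added to the
  fictitious entry 0 required to be 1.\<close>

definition step :: "nat \<Rightarrow> 'a::gcd_monoid \<Rightarrow> (nat \<Rightarrow> 'a) \<Rightarrow> (nat \<Rightarrow> 'a) \<Rightarrow> bool" where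
  "step i x f g \<longleftrightarrow> 1 \<le> i \<and> (\<exists>x' b c. lcm_pair (mul (even i)) (f i) x x' b \<and> (i = 1 \<longrightarrow> x' = 1) \<and>
     f (i + 1) = mul (even i) x c \<and> g = f(i - 1 := mul (even i) (f (i - 1)) x', i := b, i + 1 := c))"

text \<open>A domain test through common multiples only, without naming an lcm. For
  \<open>i = 1\<close>, the condition \<open>w = 1\<close> says that \<open>x\<close> divides entry
  1.\<close>

definition applicable :: "nat \<Rightarrow> 'a::gcd_monoid \<Rightarrow> (nat \<Rightarrow> 'a) \<Rightarrow> bool" where
  "applicable i x f \<longleftrightarrow> 1 \<le> i \<and> (\<exists>u. f (i + 1) = mul (even i) x u) \<and>
     (\<exists>w v. (i = 1 \<longrightarrow> w = 1) \<and> mul (even i) (f i) w = mul (even i) x v)"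

definition irreducible_at :: "nat \<Rightarrow> (nat \<Rightarrow> 'a::gcd_monoid) \<Rightarrow> bool" where
  "irreducible_at i f \<longleftrightarrow> (\<forall>x. applicable i x f \<longrightarrow> x = 1)"

definition max_elt :: "nat \<Rightarrow> (nat \<Rightarrow> 'a::gcd_monoid) \<Rightarrow> 'a" where
  "max_elt i f = (THE z. \<forall>x. applicable i x f \<longleftrightarrow> (\<exists>u. z = mul (even i) x u))"

definition max_step :: "nat \<Rightarrow> (nat \<Rightarrow> 'a::gcd_monoid) \<Rightarrow> nat \<Rightarrow> 'a" where
  "max_step i f = (THE g. step i (max_elt i f) f g)"

definition reduces_below :: "nat \<Rightarrow> (nat \<Rightarrow> 'a::gcd_monoid) \<Rightarrow> (nat \<Rightarrow> 'a) \<Rightarrow> bool" where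
  "reduces_below n f g \<longleftrightarrow> (\<exists>i x. i < n \<and> x \<noteq> 1 \<and> step i x f g)"

definition irreducible_below :: "nat \<Rightarrow> (nat \<Rightarrow> 'a::gcd_monoid) \<Rightarrow> bool" where
  "irreducible_below n f \<longleftrightarrow> (\<forall>i. 1 \<le> i \<and> i < n \<longrightarrow> irreducible_at i f)"

text \<open>Newman's lemma, by induction along the terminating relation.\<close>

lemma newman:
  assumes wf: "wfp (\<lambda>b a. r a b)"
    and local_confluence: "\<And>a b c. r a b \<Longrightarrow> r a c \<Longrightarrow> \<exists>d. r\<^sup>*\<^sup>* b d \<and> r\<^sup>*\<^sup>* c d"
    and "r\<^sup>*\<^sup>* a b" "r\<^sup>*\<^sup>* a c"
  shows "\<exists>d. r\<^sup>*\<^sup>* b d \<and> r\<^sup>*\<^sup>* c d"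
  using wf assms(3,4)
proof (induction a arbitrary: b c rule: wfp_induct_rule)
  case (less a)
  show ?case
  proof (cases "a = b \<or> a = c")
    case True
    thus ?thesis using less.prems by blast
  next
    case False
    then obtain b1 c1 where 1: "r a b1" "r\<^sup>*\<^sup>* b1 b" "r a c1" "r\<^sup>*\<^sup>* c1 c"
      using less.prems by (metis converse_rtranclpE)
    obtain d where d: "r\<^sup>*\<^sup>* b1 d" "r\<^sup>*\<^sup>* c1 d" using local_confluence 1 by blast
    obtain b2 where b2: "r\<^sup>*\<^sup>* b b2" "r\<^sup>*\<^sup>* d b2" using less.IH[OF 1(1) 1(2) d(1)] by blast
    obtain c2 where "r\<^sup>*\<^sup>* b2 c2" "r\<^sup>*\<^sup>* c c2"
      using less.IH[OF 1(3) _ 1(4), of b2] d(2) b2(2) by (metis rtranclp_trans)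
    thus ?thesis using b2(1) by (metis rtranclp_trans)
  qed
qed

lemma stepE:
  assumes "step i x f g"
  obtains x' b c where "1 \<le> i" "lcm_pair (mul (even i)) (f i) x x' b" "i = 1 \<longrightarrow> x' = 1"
    "f (i + 1) = mul (even i) x c" "g = f(i - 1 := mul (even i) (f (i - 1)) x', i := b, i + 1 := c)"
    "mul (even i) (f i) x' = mul (even i) x b"
  using assms unfolding step_def lcm_pair_def by blast

lemma step_same: "step i x f g \<Longrightarrow> k < i - 1 \<or> k > i + 1 \<Longrightarrow> g k = f k"
  by (elim stepE) auto

lemma applicable_cong: "f i = g i \<Longrightarrow> f (i + 1) = g (i + 1) \<Longrightarrow> applicable i x f \<longleftrightarrow> applicable i x g"
  by (simp add: applicable_def)

lemma irreducible_at_cong: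
  "f i = g i \<Longrightarrow> f (i + 1) = g (i + 1) \<Longrightarrow> irreducible_at i f \<longleftrightarrow> irreducible_at i g"
  unfolding irreducible_at_def using applicable_cong by metis

lemma max_elt_cong: "f i = g i \<Longrightarrow> f (i + 1) = g (i + 1) \<Longrightarrow> max_elt i f = max_elt i g"
  unfolding max_elt_def using applicable_cong by metis

locale noetherian_3Ore =
  fixes T :: "'a::gcd_monoid itself"
  assumes noetherian: "noetherian T" and three_Ore: "three_Ore T"
begin

sublocale mul: ore_monoid "mul p" "1 :: 'a" for p
  using ore_monoid_mul noetherian three_Ore unfolding noetherian_def three_Ore_def by blast

lemma step_imp_applicable: "step i (x :: 'a) f g \<Longrightarrow> applicable i x f"
  unfolding applicable_def by (elim stepE) metis

lemma applicable_imp_step: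
  assumes "applicable i (x :: 'a) f"
  shows "\<exists>g. step i x f g"
proof -
  obtain u w v where u: "1 \<le> i" "f (i + 1) = mul (even i) x u" "i = 1 \<longrightarrow> w = 1"
    "mul (even i) (f i) w = mul (even i) x v"
    using assms unfolding applicable_def by blast
  obtain x' b where xb: "lcm_pair (mul (even i)) (f i) x x' b" using mul.right_lcm[OF u(4)] by blast
  obtain w' where "w = mul (even i) x' w'" using mul.right_lcm_least[OF xb u(4)] by blast
  \<comment> \<open>For \<open>i = 1\<close> the lcm cofactor \<open>x'\<close> is a factor of
    \<open>w = 1\<close>.\<close>
  hence "i = 1 \<longrightarrow> x' = 1" using u(3) mul.no_unit by metis
  thus ?thesis using u xb unfolding step_def by blast
qed

lemma step_unique:
  assumes "step i (x :: 'a) f g" "step i x f h"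
  shows "g = h"
proof -
  obtain x' b c where 1: "lcm_pair (mul (even i)) (f i) x x' b" "f (i + 1) = mul (even i) x c"
    "g = f(i - 1 := mul (even i) (f (i - 1)) x', i := b, i + 1 := c)"
    using assms(1) by (rule stepE)
  obtain x'' b' c' where 2: "lcm_pair (mul (even i)) (f i) x x'' b'" "f (i + 1) = mul (even i) x c'"
    "h = f(i - 1 := mul (even i) (f (i - 1)) x'', i := b', i + 1 := c')"
    using assms(2) by (rule stepE)
  have "x' = x''" "b = b'" using mul.right_lcm_unique[OF 1(1) 2(1)] by auto
  moreover have "c = c'" using 1(2) 2(2) by simp
  ultimately show ?thesis using 1 2 by simp
qed

lemma step_compose:
  assumes "step i (x :: 'a) f g" "step i y g h"
  shows "step i (mul (even i) x y) f h"
proof -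
  obtain x' b c where 1: "1 \<le> i" "lcm_pair (mul (even i)) (f i) x x' b" "i = 1 \<longrightarrow> x' = 1"
    "f (i + 1) = mul (even i) x c"
    "g = f(i - 1 := mul (even i) (f (i - 1)) x', i := b, i + 1 := c)"
    using assms(1) by (rule stepE)
  obtain y' b' c' where 2: "lcm_pair (mul (even i)) (g i) y y' b'" "i = 1 \<longrightarrow> y' = 1"
    "g (i + 1) = mul (even i) y c'"
    "h = g(i - 1 := mul (even i) (g (i - 1)) y', i := b', i + 1 := c')"
    using assms(2) by (rule stepE)
  have "g i = b" "g (i + 1) = c" "g (i - 1) = mul (even i) (f (i - 1)) x'" using 1 by auto
  hence "f (i + 1) = mul (even i) (mul (even i) x y) c'"
    "h = f(i - 1 := mul (even i) (f (i - 1)) (mul (even i) x' y'), i := b', i + 1 := c')"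
    using 1(4,5) 2(3,4) by (simp_all add: mul.assoc)
  moreover have "lcm_pair (mul (even i)) (f i) (mul (even i) x y) (mul (even i) x' y') b'"
    using mul.lcm_compose[OF 1(2)] 2(1) \<open>g i = b\<close> by simp
  moreover have "i = 1 \<longrightarrow> mul (even i) x' y' = 1" using 1(3) 2(2) by simp
  ultimately show ?thesis using 1(1) unfolding step_def by blast
qed

text \<open>A converse to \<open>step_compose\<close>: dividing a composite reducer by the part
  already applied leaves a reducer.\<close>

lemma applicable_quotient:
  assumes "step i (x :: 'a) f g" "applicable i (mul (even i) x y) f"
  shows "applicable i y g"
proof -
  obtain x' b c where 1: "1 \<le> i" "lcm_pair (mul (even i)) (f i) x x' b" "i = 1 \<longrightarrow> x' = 1"
    "f (i + 1) = mul (even i) x c"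
    "g = f(i - 1 := mul (even i) (f (i - 1)) x', i := b, i + 1 := c)"
    using assms(1) by (rule stepE)
  obtain u w v where u: "f (i + 1) = mul (even i) (mul (even i) x y) u" "i = 1 \<longrightarrow> w = 1"
    "mul (even i) (f i) w = mul (even i) (mul (even i) x y) v"
    using assms(2) unfolding applicable_def by blast
  have "c = mul (even i) y u" using u(1) 1(4) by (simp add: mul.assoc)
  moreover obtain w' where w': "w = mul (even i) x' w'" "mul (even i) y v = mul (even i) b w'"
    using mul.right_lcm_least[OF 1(2)] u(3) by (metis mul.assoc)
  moreover have "i = 1 \<longrightarrow> w' = 1" using w'(1) u(2) mul.no_unit' by metis
  moreover have "g i = b" "g (i + 1) = c" using 1(5) by auto
  ultimately show ?thesis using 1(1) unfolding applicable_def by metis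
qed

lemma max_elt:
  assumes "1 \<le> i"
  shows "applicable i (x :: 'a) f \<longleftrightarrow> (\<exists>u. max_elt i f = mul (even i) x u)"
proof -
  obtain z where "\<forall>x. (\<exists>u. f (i + 1) = mul (even i) x u) \<and>
      (\<exists>w v. (i = 1 \<longrightarrow> w = 1) \<and> mul (even i) (f i) w = mul (even i) x v) \<longleftrightarrow> (\<exists>u. z = mul (even i) x u)"
    using mul.max_divisor by (rule exE)
  hence z: "applicable i x f \<longleftrightarrow> (\<exists>u. z = mul (even i) x u)" for x
    using assms by (simp add: applicable_def)
  have "max_elt i f = z" unfolding max_elt_def
  proof (rule the_equality)
    show "\<forall>x. applicable i x f \<longleftrightarrow> (\<exists>u. z = mul (even i) x u)" using z by blast
    fix y assume y: "\<forall>x. applicable i x f \<longleftrightarrow> (\<exists>u. y = mul (even i) x u)"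
    have "\<exists>u. y = mul (even i) z u" using y z mul.unit_right by metis
    then obtain u where u: "y = mul (even i) z u" ..
    have "\<exists>v. z = mul (even i) y v" using y z mul.unit_right by metis
    then obtain v where "mul (even i) z 1 = mul (even i) z (mul (even i) u v)"
      using u by (auto simp: mul.assoc)
    hence "u = 1" using mul.no_unit by (metis mul.cancel_left)
    thus "y = z" using u by simp
  qed
  with z show ?thesis by simp
qed

lemma step_max_step:
  assumes "1 \<le> i"
  shows "step i (max_elt i f :: 'a) f (max_step i f)"
proof -
  have "applicable i (max_elt i f) f" using max_elt[OF assms] mul.unit_right by metis
  then obtain g where g: "step i (max_elt i f) f g" using applicable_imp_step by blast
  hence "max_step i f = g" unfolding max_step_def using step_unique by blast
  with g show ?thesis by simp
qed

text \<open>Every reducer divides the maximal one, and the remaining factor is still applicable.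
  This joins any two steps at the same level.\<close>

lemma step_to_max_step:
  assumes "step i (x :: 'a) f g"
  obtains y where "step i y g (max_step i f)"
proof -
  have i: "1 \<le> i" using assms by (rule stepE)
  have "applicable i x f" using step_imp_applicable assms by blast
  then obtain y where y: "max_elt i f = mul (even i) x y" using max_elt[OF i] by blast
  have "applicable i (mul (even i) x y) f" using step_imp_applicable[OF step_max_step[OF i, of f]] y by simp
  then obtain h where h: "step i y g h"
    using applicable_quotient[OF assms] applicable_imp_step by blast
  hence "step i (mul (even i) x y) f h" using step_compose assms by blast
  hence "h = max_step i f" using step_unique step_max_step[OF i] y by metis
  with h that show thesis by blast
qed

text \<open>A further reducer \<open>y\<close> would compose with the maximal element to a multiple
  of it that also divides it.\<close>

lemma irreducible_at_max_step:
  assumes "1 \<le> i"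
  shows "irreducible_at i (max_step i (f :: nat \<Rightarrow> 'a))"
  unfolding irreducible_at_def
proof (intro allI impI)
  fix y assume "applicable i y (max_step i f)"
  then obtain g where "step i y (max_step i f) g" using applicable_imp_step by blast
  hence "applicable i (mul (even i) (max_elt i f) y) f"
    using step_compose step_max_step[OF assms] step_imp_applicable by blast
  then obtain u where "mul (even i) (max_elt i f) 1 = mul (even i) (max_elt i f) (mul (even i) y u)"
    using max_elt[OF assms] by (auto simp: mul.assoc)
  thus "y = 1" using mul.no_unit by (metis mul.cancel_left)
qed

lemma step_one: "1 \<le> i \<Longrightarrow> step i (1 :: 'a) f f"
proof -
  assume "1 \<le> i"
  have "lcm_pair (mul p) (f i) 1 1 (f i)" for p unfolding lcm_pair_def by simp
  with \<open>1 \<le> i\<close> show ?thesis unfolding step_def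
    by (intro conjI exI[of _ 1] exI[of _ "f i"] exI[of _ "f (i + 1)"]) auto
qed

lemma step_one_eq: "step i (1 :: 'a) f g \<Longrightarrow> g = f"
  using step_one step_unique by (metis stepE)

section \<open>Irreducibility under steps at higher levels\<close>

lemma step_preserves_irreducible:
  assumes i: "2 \<le> i" and step: "step i (x :: 'a) f g" and irr: "irreducible_at (i - 1) f"
  shows "irreducible_at (i - 1) g"
  unfolding irreducible_at_def
proof (intro allI impI)
  obtain j where j: "i = Suc j" "1 \<le> j" using i by (cases i) auto
  obtain x' b c where 1: "lcm_pair (mul (even i)) (f i) x x' b"
    "g = f(i - 1 := mul (even i) (f (i - 1)) x', i := b, i + 1 := c)"
    using step by (rule stepE)
  fix y assume "applicable (i - 1) y g"
  then obtain u w v where u: "b = mul (even i) u y" "j = 1 \<longrightarrow> w = 1"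
    "mul (even i) w (mul (even i) (f j) x') = mul (even i) v y"
    using 1 j unfolding applicable_def by (auto simp: mul_flip)
  have irr': "y = 1" if "f i = mul (even i) u y" "j = 1 \<longrightarrow> w = 1" "mul (even i) w (f j) = mul (even i) v y"
    for y u w v
    using irr that j unfolding irreducible_at_def applicable_def
    by (simp only: even_Suc mul_flip) (metis diff_Suc_1 even_Suc mul_flip Suc_eq_plus1)
  show "y = 1" by (rule mul.preserve_irreducible[OF irr' 1(1) u])
qed

lemma double_step_preserves_irreducible:
  assumes j: "3 \<le> j" and f1: "irreducible_at (j - 2) f" and f2: "irreducible_at (j - 1) f"
    and step1: "step j (x :: 'a) f g" and step2: "step (j - 2) z g h"
  shows "irreducible_at (j - 1) h"
  unfolding irreducible_at_def
proof (intro allI impI)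
  obtain i where i: "j = Suc (Suc i)" "1 \<le> i" 
    using j by (metis Suc_le_D Suc_le_mono numeral_3_eq_3 One_nat_def)
  \<comment> \<open>\<open>p\<close> is the parity of the middle level \<open>j - 1\<close>; levels
    \<open>j\<close> and \<open>j - 2\<close> use the reversed multiplication.\<close>
  define p where "p = (odd i)"
  have par: "even i = (\<not> p)" "even (Suc i) = p" by (simp_all add: p_def)
  obtain x' b c where 1: "lcm_pair (\<lambda>x y. mul p y x) (f j) x x' b"
    "g = f(j - 1 := mul p x' (f (j - 1)), j := b, j + 1 := c)"
    using step1 i par by (elim stepE) (simp add: lcm_pair_flip mul_flip)
  obtain z' d q1 where 2: "lcm_pair (\<lambda>x y. mul p y x) (g i) z z' d" "i = 1 \<longrightarrow> z' = 1"
    "g (i + 1) = mul p q1 z" "h = g(i - 1 := mul p z' (g (i - 1)), i := d, i + 1 := q1)"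
    "mul p z' (g i) = mul p d z"
    using step2 i par by (elim stepE) (simp add: lcm_pair_flip mul_flip)
  have z: "mul p x' (f (Suc i)) = mul p q1 z" "mul p z' (f i) = mul p d z" using 1 2 i by auto
  fix y assume "applicable (j - 1) y h"
  moreover have "h (Suc i) = q1" "h (Suc (Suc i)) = b" using 1(2) 2(4) i by auto
  ultimately obtain u w v where y: "b = mul p y u" "mul p q1 w = mul p y v"
    using i par(2) unfolding applicable_def by auto
  have irr1: "y = 1" if "f (Suc i) = mul p u y" "i = 1 \<longrightarrow> w = 1" "mul p w (f i) = mul p v y"
    for y u w v
    using f1 that i par unfolding irreducible_at_def applicable_def
    by (simp add: mul_flip) blast
  have irr2: "y = 1" if "f j = mul p y u" "mul p (f (Suc i)) w = mul p y v" for y u w v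
    using f2 that i par unfolding irreducible_at_def applicable_def
    by simp blast
  show "y = 1" by (rule mul.double_step_irreducible[OF irr1 irr2 1(1) z(1) 2(2) z(2) y])
qed

lemma step_reduces_below: "i < n \<Longrightarrow> step i (x :: 'a) f g \<Longrightarrow> (reduces_below n)\<^sup>*\<^sup>* f g"
proof (cases "x = 1")
  case True
  moreover assume "step i x f g"
  ultimately show ?thesis using step_one_eq by blast
next
  case False
  moreover assume "i < n" "step i x f g"
  ultimately show ?thesis unfolding reduces_below_def by blast
qed

section \<open>Local confluence, termination and normal forms\<close>

lemma step_commute:
  assumes f: "step i (x :: 'a) f g" "step j y f h" and ij: "i + 2 \<le> j"
  shows "\<exists>k. step j y g k \<and> step i x h k"
proof -
  obtain x' b c where 1: "1 \<le> i" "lcm_pair (mul (even i)) (f i) x x' b" "i = 1 \<longrightarrow> x' = 1"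
    "f (i + 1) = mul (even i) x c"
    "g = f(i - 1 := mul (even i) (f (i - 1)) x', i := b, i + 1 := c)"
    using f(1) by (rule stepE)
  obtain y' b' c' where 2: "lcm_pair (mul (even j)) (f j) y y' b'" "j = 1 \<longrightarrow> y' = 1"
    "f (j + 1) = mul (even j) y c'"
    "h = f(j - 1 := mul (even j) (f (j - 1)) y', j := b', j + 1 := c')"
    using f(2) by (rule stepE)
  define k where "k = g(j - 1 := mul (even j) (g (j - 1)) y', j := b', j + 1 := c')"
  obtain r where r: "i = Suc r" using 1(1) by (cases i) auto
  have "g j = f j" "g (j + 1) = f (j + 1)" using ij by (simp_all add: 1(5) r)
  hence "lcm_pair (mul (even j)) (g j) y y' b'" "g (j + 1) = mul (even j) y c'" using 2(1,3) by simp_all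
  moreover have "1 \<le> j" using ij by simp
  ultimately have "step j y g k" using 2(2) k_def unfolding step_def by blast
  moreover have "step i x h k"
  \<comment> \<open>At distance 2 both steps touch entry \<open>i + 1 = j - 1\<close>, but on
    opposite sides: for \<open>mul (even i)\<close>, one divides by \<open>x\<close> on the left and
    the other multiplies by \<open>y'\<close> on the right.\<close>
  proof (cases "j = i + 2")
    case True
    have "h i = f i" and h: "h (i + 1) = mul (even i) x (mul (even i) c y')"
      "k = h(i - 1 := mul (even i) (h (i - 1)) x', i := b, i + 1 := mul (even i) c y')"
      using 1(4) by (simp_all add: 1(5) 2(4) k_def True r fun_eq_iff mul.assoc)
    hence "lcm_pair (mul (even i)) (h i) x x' b" using 1(2) by simp
    thus ?thesis using 1(1,3) h unfolding step_def by blast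
  next
    case False
    then obtain d where d: "j = Suc (Suc (Suc (Suc (r + d))))"
      using ij r less_imp_Suc_add[of "i + 2" j] by auto
    have "h i = f i" and h: "h (i + 1) = mul (even i) x c"
      "k = h(i - 1 := mul (even i) (h (i - 1)) x', i := b, i + 1 := c)"
      using 1(4) by (simp_all add: 1(5) 2(4) k_def d r fun_eq_iff)
    hence "lcm_pair (mul (even i)) (h i) x x' b" using 1(2) by simp
    thus ?thesis using 1(1,3) h unfolding step_def by blast
  qed
  ultimately show ?thesis by blast
qed

lemma step_overlap:
  assumes f: "step i (x :: 'a) f g" "step (Suc i) y f h"
  obtains s x1 k1 k2 where "step (Suc i) y g k1" "step i s h k2"
    "k1 = k2 \<or> step (i - 1) x1 k1 k2"
proof -
  define p where "p = even i"
  obtain x' a1 b1 where 1: "1 \<le> i" "lcm_pair (mul p) (f i) x x' a1" "i = 1 \<longrightarrow> x' = 1"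
    "f (Suc i) = mul p x b1"
    "g = f(i - 1 := mul p (f (i - 1)) x', i := a1, Suc i := b1)"
    using f(1) unfolding p_def by (elim stepE) simp
  have par: "even i = p" "even (Suc i) = (\<not> p)" by (simp_all add: p_def)
  obtain y' c2 c1 where 2: "lcm_pair (\<lambda>x y. mul p y x) (f (Suc i)) y y' c2"
    "f (Suc (Suc i)) = mul p c1 y"
    "h = f(i := mul p y' (f i), Suc i := c2, Suc (Suc i) := c1)"
    using f(2) par by (elim stepE) (simp add: lcm_pair_flip mul_flip)
  obtain y'' d s t e x1 where 3: "lcm_pair (\<lambda>x y. mul p y x) b1 y y'' d" "mul p s d = c2"
    "lcm_pair (mul p) (mul p y' (f i)) s t e" "x' = mul p t x1" "mul p y'' a1 = mul p e x1"
    using mul.overlap[OF 1(2) 1(4)[symmetric] 2(1)] .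
  define k1 where "k1 = g(i := mul p y'' (g i), Suc i := d, Suc (Suc i) := c1)"
  have "g (Suc i) = b1" "g (Suc (Suc i)) = mul p c1 y" using 1(5) 2(2) by auto
  hence k1: "step (Suc i) y g k1" using 3(1) 1(1) unfolding step_def par
    by (auto simp: lcm_pair_flip mul_flip k1_def)
  define k2 where "k2 = h(i - 1 := mul p (h (i - 1)) t, i := e, Suc i := d)"
  have t: "i = 1 \<longrightarrow> t = 1 \<and> x1 = 1" using 1(3) 3(4) mul.no_unit mul.no_unit' by metis
  have "h i = mul p y' (f i)" "h (Suc i) = mul p s d" using 2(3) 3(2) by auto
  hence k2: "step i s h k2" using 1(1) 3(3) t unfolding step_def par by (auto simp: k2_def)
  have k12: "k2 = k1(i - 1 := mul p (f (i - 1)) t, i := e)"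
    "k1 (i - 1) = mul p (mul p (f (i - 1)) t) x1" "k1 i = mul p e x1"
    using 1(1,5) 2(3) 3(4,5) by (auto simp: k1_def k2_def mul.assoc)
  have "k1 = k2 \<or> step (i - 1) x1 k1 k2"
  proof (cases "i = 1")
    \<comment> \<open>There is no level 0 to correct the difference, but \<open>x' = 1\<close>
      forces \<open>t = x1 = 1\<close>, so the results coincide.\<close>
    case True
    thus ?thesis using t k12 by (auto simp: fun_eq_iff)
  next
    case False
    then obtain j where j: "i = Suc j" "1 \<le> j" using 1(1) by (cases i) auto
    hence par': "even j = (\<not> p)" using par by auto
    \<comment> \<open>\<open>x1\<close> already divides entry \<open>i - 1\<close>, so the lcm is
      that entry itself and the cofactor passed to entry \<open>i - 2\<close> is 1.\<close>
    have "lcm_pair (\<lambda>x y. mul p y x) (k1 j) x1 1 (mul p (f j) t)"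
      using k12(2) j unfolding lcm_pair_def by simp
    moreover have "k2 = k1(j - 1 := mul p 1 (k1 (j - 1)), j := mul p (f j) t, j + 1 := e)"
      using k12(1) j by simp
    ultimately have "step j x1 k1 k2"
      using j k12(3) unfolding step_def par' lcm_pair_flip mul_flip
      by (intro conjI exI[of _ 1] exI[of _ "mul p (f j) t"] exI[of _ e]) simp_all
    thus ?thesis using j by simp
  qed
  with k1 k2 that show thesis by blast
qed

lemma step_locally_confluent:
  assumes "step i (x :: 'a) f g" "step j y f h" "i \<le> j" "j < n"
  shows "\<exists>k. (reduces_below n)\<^sup>*\<^sup>* g k \<and> (reduces_below n)\<^sup>*\<^sup>* h k"
proof -
  consider "j = i" | "j = Suc i" | "i + 2 \<le> j" using assms(3) by linarith
  thus ?thesis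
  proof cases
    case 1
    obtain x1 where "step i x1 g (max_step i f)" using assms(1) by (rule step_to_max_step)
    moreover obtain y1 where "step i y1 h (max_step i f)"
      using assms(2) unfolding 1 by (rule step_to_max_step)
    ultimately show ?thesis using step_reduces_below assms(4) 1 by blast
  next
    case 2
    obtain s x1 k1 k2 where k: "step (Suc i) y g k1" "step i s h k2" "k1 = k2 \<or> step (i - 1) x1 k1 k2"
      using step_overlap[OF assms(1)] assms(2) 2 by metis
    have "(reduces_below n)\<^sup>*\<^sup>* g k1" "(reduces_below n)\<^sup>*\<^sup>* h k2" "(reduces_below n)\<^sup>*\<^sup>* k1 k2"
      using step_reduces_below[OF _ k(1), of n] step_reduces_below[OF _ k(2), of n] k(3)
        step_reduces_below[of "i - 1" n x1 k1 k2] assms(4) 2 by (simp, simp, auto)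
    thus ?thesis by (meson rtranclp_trans)
  next
    case 3
    thus ?thesis
      using step_commute[OF assms(1,2)] step_reduces_below assms(3,4) by (meson le_less_trans)
  qed
qed

text \<open>Lexicographic descent with entry \<open>n + 1\<close> first: among the levels up to
  \<open>n\<close>, only level \<open>n\<close> changes this entry, and it replaces it by a proper
  factor.\<close>

lemma reduces_below_terminates: "wfp (\<lambda>g f :: nat \<Rightarrow> 'a. reduces_below n f g)"
proof (induction n)
  case 0
  show ?case by (simp add: reduces_below_def)
next
  case (Suc n)
  let ?A = "{(a, b :: 'a). \<exists>x. x \<noteq> 1 \<and> b = mul (even n) x a}"
  let ?B = "{(g, f :: nat \<Rightarrow> 'a). reduces_below n f g}"
  have "wf (inv_image (?A <*lex*> ?B) (\<lambda>f. (f (n + 1), f)))"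
    using mul.wf_factor[of "even n"] Suc by (intro wf_inv_image wf_lex_prod) (simp_all add: wfp_def)
  moreover have "{(g, f :: nat \<Rightarrow> 'a). reduces_below (Suc n) f g}
      \<subseteq> inv_image (?A <*lex*> ?B) (\<lambda>f. (f (n + 1), f))"
  proof clarify
    fix g f :: "nat \<Rightarrow> 'a" assume "reduces_below (Suc n) f g"
    then obtain i x where ix: "i < Suc n" "x \<noteq> 1" "step i x f g"
      unfolding reduces_below_def by blast
    show "(g, f) \<in> inv_image (?A <*lex*> ?B) (\<lambda>f. (f (n + 1), f))"
    proof (cases "i = n")
      case True
      have "f (n + 1) = mul (even n) x (g (n + 1))"
        using ix(3) unfolding True by (elim stepE) simp
      thus ?thesis using ix(2) by auto
    next
      case False
      hence "g (n + 1) = f (n + 1)" "reduces_below n f g"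
        using ix(1) step_same[OF ix(3)] ix(2,3) unfolding reduces_below_def
        by (simp, metis less_antisym)
      thus ?thesis by simp
    qed
  qed
  ultimately have "wf {(g, f :: nat \<Rightarrow> 'a). reduces_below (Suc n) f g}" by (rule wf_subset)
  thus ?case by (simp add: wfp_def)
qed

lemma reduces_below_confluent:
  assumes "(reduces_below n)\<^sup>*\<^sup>* (f :: nat \<Rightarrow> 'a) g" "(reduces_below n)\<^sup>*\<^sup>* f h"
  shows "\<exists>k. (reduces_below n)\<^sup>*\<^sup>* g k \<and> (reduces_below n)\<^sup>*\<^sup>* h k"
proof (rule newman[OF reduces_below_terminates _ assms])
  fix f g h :: "nat \<Rightarrow> 'a" assume "reduces_below n f g" "reduces_below n f h"
  then obtain i x j y where "i < n" "step i x f g" "j < n" "step j y f h"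
    unfolding reduces_below_def by blast
  thus "\<exists>k. (reduces_below n)\<^sup>*\<^sup>* g k \<and> (reduces_below n)\<^sup>*\<^sup>* h k"
    using step_locally_confluent[of i x f g j y h n] step_locally_confluent[of j y f h i x g n]
    by (meson nat_le_linear)
qed

lemma irreducible_below_iff: "irreducible_below n f \<longleftrightarrow> (\<nexists>g :: nat \<Rightarrow> 'a. reduces_below n f g)"
  unfolding irreducible_below_def irreducible_at_def reduces_below_def
  using applicable_imp_step step_imp_applicable by (blast elim: stepE)

lemma normal_form_unique:
  assumes "(reduces_below n)\<^sup>*\<^sup>* (f :: nat \<Rightarrow> 'a) g" "(reduces_below n)\<^sup>*\<^sup>* f h"
    and "irreducible_below n g" "irreducible_below n h"
  shows "g = h"
  using reduces_below_confluent[OF assms(1,2)] assms(3,4) unfolding irreducible_below_iff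
  by (metis converse_rtranclpE)

lemma reduces_below_same:
  assumes "(reduces_below n)\<^sup>*\<^sup>* f (g :: nat \<Rightarrow> 'a)" "n < k"
  shows "g k = f k"
  using assms
proof (induction rule: rtranclp_induct)
  case (step g h)
  then obtain i x where "i < n" "step i x g h" unfolding reduces_below_def by blast
  thus ?case using step_same[of i x g h k] step by simp
qed simp

lemma reduces_below_mono:
  assumes "(reduces_below m)\<^sup>*\<^sup>* f (g :: nat \<Rightarrow> 'a)" "m \<le> n"
  shows "(reduces_below n)\<^sup>*\<^sup>* f g"
  by (rule mono_rtranclp[rule_format, OF _ assms(1)])
    (use assms(2) less_le_trans in \<open>unfold reduces_below_def, blast\<close>)

section \<open>Restoring irreducibility after a top-level step\<close>

text \<open>The bound \<open>j - 1\<close> keeps entries \<open>j\<close> and \<open>j + 1\<close>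
  fixed and, for \<open>j = n - 1\<close>, matches the levels of \<open>U (n - 2)\<close>. The
  induction continues at \<open>j - 2\<close> with \<open>g\<close> in the role of \<open>f\<close>,
  as an \<open>R_j\<close>-step leaves alone the entries on which the levels below
  \<open>j - 2\<close> depend.\<close>

lemma irreducible_after_step:
  assumes "\<And>i. 1 \<le> i \<Longrightarrow> i < j \<Longrightarrow> irreducible_at i f"
    and "step j (x :: 'a) f g" and "irreducible_at j g"
  shows "\<exists>h. (reduces_below (j - 1))\<^sup>*\<^sup>* g h \<and> irreducible_below (j + 1) h"
  using assms
proof (induction j arbitrary: f x g rule: less_induct)
  case (less j)
  have j: "1 \<le> j" using less.prems(2) by (rule stepE)
  have g: "irreducible_at (j - 1) g" if "2 \<le> j"
    using step_preserves_irreducible[OF that less.prems(2)] less.prems(1)[of "j - 1"] that by auto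
  show ?case
  proof (cases "3 \<le> j")
    case False
    hence "irreducible_at i g" if "1 \<le> i" "i < j + 1" for i
      using that less.prems(3) g j by (cases "i = j"; cases "i = j - 1") auto
    thus ?thesis unfolding irreducible_below_def by blast
  next
    case True
    define g' where "g' = max_step (j - 2) g"
    have step: "step (j - 2) (max_elt (j - 2) g) g g'"
      using step_max_step True unfolding g'_def by simp
    have "irreducible_at i g" if "1 \<le> i" "i < j - 2" for i
      using less.prems(1)[of i] that step_same[OF less.prems(2)]
        irreducible_at_cong[of f i g] by auto
    moreover have "irreducible_at (j - 2) g'"
      using irreducible_at_max_step True unfolding g'_def by simp
    ultimately obtain h where h: "(reduces_below (j - 2 - 1))\<^sup>*\<^sup>* g' h"
      "irreducible_below (j - 2 + 1) h"
      using less.IH[OF _ _ step] True by auto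
    have "(reduces_below (j - 1))\<^sup>*\<^sup>* g g'" using step_reduces_below[OF _ step] True by simp
    moreover have "(reduces_below (j - 1))\<^sup>*\<^sup>* g' h" using reduces_below_mono[OF h(1)] by simp
    ultimately have gh: "(reduces_below (j - 1))\<^sup>*\<^sup>* g h" by simp
    \<comment> \<open>Level \<open>j - 1\<close> survives the step at \<open>j - 2\<close> by the
      double-step argument; the steps from \<open>g'\<close> to \<open>h\<close> are at levels below
      \<open>j - 3\<close> and do not reach its entries.\<close>
    have "irreducible_at (j - 1) g'"
      using double_step_preserves_irreducible[OF True _ _ less.prems(2) step]
        less.prems(1)[of "j - 2"] less.prems(1)[of "j - 1"] True by simp
    hence j1: "irreducible_at (j - 1) h"
      using reduces_below_same[OF h(1)] True irreducible_at_cong[of h "j - 1" g'] by simp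
    have j0: "irreducible_at j h"
      using less.prems(3) reduces_below_same[OF gh] irreducible_at_cong[of h j g] True by simp
    have "irreducible_at i h" if i: "1 \<le> i" "i < j + 1" for i
    proof -
      consider "i < j - 2 + 1" | "i = j - 1" | "i = j" using i True by linarith
      thus ?thesis using j0 j1 h(2) i unfolding irreducible_below_def by cases auto
    qed
    thus ?thesis using gh unfolding irreducible_below_def by blast
  qed
qed

text \<open>The strict inequalities \<open>i < m < j\<close> give the distance 2 needed for
  commutation, and the maximal element at \<open>j\<close> depends only on entries that the lower
  steps leave unchanged.\<close>

lemma reduces_below_max_step:
  assumes "(reduces_below m)\<^sup>*\<^sup>* f (g :: nat \<Rightarrow> 'a)" "m < j"
  shows "(reduces_below m)\<^sup>*\<^sup>* (max_step j f) (max_step j g)"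
  using assms
proof (induction rule: rtranclp_induct)
  case (step g h)
  then obtain i x where ix: "i < m" "x \<noteq> 1" "step i x g h" unfolding reduces_below_def by blast
  have j: "1 \<le> j" using step.prems by simp
  have "max_elt j h = max_elt j g"
    using step_same[OF ix(3)] ix(1) step.prems by (intro max_elt_cong) auto
  moreover obtain k where "step j (max_elt j g) h k" "step i x (max_step j g) k"
    using step_commute[OF ix(3) step_max_step[OF j]] ix(1) step.prems by auto
  ultimately have "step i x (max_step j g) (max_step j h)"
    using step_unique step_max_step[OF j] by metis
  with ix have "reduces_below m (max_step j g) (max_step j h)" unfolding reduces_below_def by blast
  with step show ?case by simp
qed simp

lemma reduces_below_foldl:
  assumes "set is \<subseteq> {1..<n}"
  shows "(reduces_below n)\<^sup>*\<^sup>* (f :: nat \<Rightarrow> 'a) (foldl (\<lambda>g i. max_step i g) f is)"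
  using assms
proof (induction "is" arbitrary: f)
  case (Cons i "is")
  hence "(reduces_below n)\<^sup>*\<^sup>* f (max_step i f)"
    using step_reduces_below[OF _ step_max_step] by simp
  with Cons show ?case by (simp add: rtranclp_trans)
qed simp

end

section \<open>The sequence \<open>U n\<close> reaches the normal form\<close>

text \<open>Valid for all \<open>n\<close> by truncated subtraction: for \<open>n \<le> 1\<close>
  both parts are empty.\<close>

lemma U_rec: "U n = [1..<n] @ U (n - 2)"
proof (cases "n \<le> 1")
  case True
  hence "U n = []" "U (n - 2) = []" by (subst U.simps, simp)+
  thus ?thesis using True by simp
next
  case False
  thus ?thesis by (subst U.simps) simp
qed

lemma set_U: "set (U n) \<subseteq> {1..<n}"
proof (induction n rule: less_induct)
  case (less n)
  show ?case
  proof (cases "n \<le> 1")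
    case True
    thus ?thesis by (simp add: U.simps)
  next
    case False
    thus ?thesis using less[of "n - 2"] by (subst U_rec) fastforce
  qed
qed

context noetherian_3Ore
begin

lemma irreducible_below_U:
  "irreducible_below n (foldl (\<lambda>g i. max_step i g) (f :: nat \<Rightarrow> 'a) (U n))"
proof (induction n arbitrary: f rule: less_induct)
  case (less n)
  show ?case
  proof (cases "n \<le> 1")
    case True
    thus ?thesis unfolding irreducible_below_def by auto
  next
    case False
    let ?R = "foldl (\<lambda>g i. max_step i g)"
    define c where "c = ?R f [1..<n - 1]"
    \<comment> \<open>\<open>c'\<close> is a detour for the comparison: \<open>U n\<close> applies
      its step at level \<open>n - 1\<close> to \<open>c\<close>, not to \<open>c'\<close>.\<close>
    define c' where "c' = ?R c (U (n - 3))"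
    define b where "b = max_step (n - 1) c"
    have n: "1 \<le> n - 1" "Suc (n - 1) = n" using False by auto
    have "?R f (U (n - 1)) = c'"
      by (subst U_rec) (simp add: c_def c'_def numeral_3_eq_3 numeral_2_eq_2)
    hence c': "irreducible_below (n - 1) c'" using less[of "n - 1" f] False by simp
    have "(reduces_below (n - 3))\<^sup>*\<^sup>* c c'" unfolding c'_def by (rule reduces_below_foldl[OF set_U])
    hence "(reduces_below (n - 3))\<^sup>*\<^sup>* b (max_step (n - 1) c')"
      unfolding b_def using n by (intro reduces_below_max_step) auto
    hence 1: "(reduces_below (n - 2))\<^sup>*\<^sup>* b (max_step (n - 1) c')" by (rule reduces_below_mono) simp
    have "\<exists>h. (reduces_below (n - 1 - 1))\<^sup>*\<^sup>* (max_step (n - 1) c') h \<and> irreducible_below (n - 1 + 1) h"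
      by (rule irreducible_after_step[OF _ step_max_step[OF n(1)] irreducible_at_max_step[OF n(1)]])
        (use c' in \<open>simp add: irreducible_below_def\<close>)
    then obtain h where h: "(reduces_below (n - 2))\<^sup>*\<^sup>* (max_step (n - 1) c') h" "irreducible_below n h"
      using n by (auto simp: numeral_2_eq_2)
    have bh: "(reduces_below (n - 2))\<^sup>*\<^sup>* b h" using 1 h(1) by simp
    \<comment> \<open>\<open>h\<close> and the result of \<open>U (n - 2)\<close> are both normal
      forms of \<open>b\<close> for the levels below \<open>n - 2\<close>, hence equal;
      irreducibility at levels \<open>n - 2\<close> and \<open>n - 1\<close> then comes from
      \<open>h\<close>.\<close>
    have "irreducible_below (n - 2) (?R b (U (n - 2)))" using less[of "n - 2" b] False by simp
    moreover have "irreducible_below (n - 2) h" using h(2) unfolding irreducible_below_def by auto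
    ultimately have "?R b (U (n - 2)) = h"
      using normal_form_unique reduces_below_foldl[OF set_U] bh by blast
    moreover have "[1..<n] = [1..<n - 1] @ [n - 1]" using upt_Suc_append[OF n(1)] n(2) by simp
    hence "?R f (U n) = ?R b (U (n - 2))" by (subst U_rec) (simp add: b_def c_def)
    ultimately show ?thesis using h(2) by simp
  qed
qed

end

section \<open>Transfer between lists and functions\<close>

definition seq :: "'a::one list \<Rightarrow> nat \<Rightarrow> 'a" where
  "seq a k = (if 1 \<le> k \<and> k \<le> length a then entry a k else 1)"

lemma seq_eqD:
  assumes "seq a = seq b" "length a = length b"
  shows "a = b"
proof (rule nth_equalityI[OF assms(2)])
  fix k assume "k < length a"
  thus "a ! k = b ! k" using fun_cong[OF assms(1), of "Suc k"] assms(2) by (simp add: seq_def entry_def)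
qed

lemma seq_surj:
  assumes "\<And>k. k = 0 \<or> n < k \<Longrightarrow> g k = 1"
  obtains b where "length b = n" "seq b = g"
proof
  show "length (map (\<lambda>k. g (Suc k)) [0..<n]) = n" by simp
  show "seq (map (\<lambda>k. g (Suc k)) [0..<n]) = g"
  proof
    fix k show "seq (map (\<lambda>k. g (Suc k)) [0..<n]) k = g k"
      using assms[of k] by (cases k) (auto simp: seq_def entry_def)
  qed
qed

text \<open>Entry \<open>i - 1\<close> is expressed through \<open>seq\<close> because for
  \<open>i = 1\<close> it is the fictitious entry 0.\<close>

lemma seq_eq_upd_iff:
  assumes "length b = length a" "1 \<le> i" "i < length a"
  shows "seq b = (seq a)(i - 1 := u, i := v, i + 1 := w) \<longleftrightarrow>
    (\<forall>k\<in>{1..length a} - {i - 1, i, i + 1}. entry b k = entry a k) \<and>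
    seq b (i - 1) = u \<and> entry b i = v \<and> entry b (i + 1) = w" (is "?L \<longleftrightarrow> ?R")
proof
  have eq: "entry b i = seq b i" "entry b (i + 1) = seq b (i + 1)"
    using assms by (simp_all add: seq_def)
  {
    assume ?L
    moreover have "entry b k = entry a k" if "k \<in> {1..length a} - {i - 1, i, i + 1}" for k
      using that fun_cong[OF \<open>?L\<close>, of k] assms by (simp add: seq_def)
    moreover have "i - 1 \<noteq> i" "i - 1 \<noteq> i + 1" using assms(2) by auto
    ultimately show ?R unfolding eq by simp
  next
    assume R: ?R
    show ?L
    proof
      fix k
      consider "k = i + 1" | "k = i" | "k = i - 1" | "k \<in> {1..length a} - {i - 1, i, i + 1}"
        | "k \<notin> {1..length a}" "k \<noteq> i - 1" "k \<noteq> i" "k \<noteq> i + 1" by blast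
      thus "seq b k = ((seq a)(i - 1 := u, i := v, i + 1 := w)) k"
      proof cases
        case 4
        hence "entry b k = entry a k" using R by blast
        thus ?thesis using 4 assms(1) by (simp add: seq_def)
      next
        case 5
        thus ?thesis using assms(1) by (auto simp: seq_def)
      qed (use R assms(2) eq in auto)
    qed
  }
qed

lemma is_right_lcm_iff:
  assumes "x * b = a * x'"
  shows "is_right_lcm x a (a * x') \<longleftrightarrow> lcm_pair (*) (a :: 'a::gcd_monoid) x x' b"
proof
  assume l: "is_right_lcm x a (a * x')"
  have "\<exists>w. s = x' * w" if "a * s = x * t" for s t
  proof -
    have "left_dvd x (a * s)" "left_dvd a (a * s)" using that unfolding left_dvd_def by blast+
    then obtain w where "a * s = a * x' * w" using l unfolding is_right_lcm_def left_dvd_def by blast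
    thus ?thesis using left_cancel by (auto simp: mult.assoc)
  qed
  thus "lcm_pair (*) a x x' b" using assms unfolding lcm_pair_def by metis
next
  assume l: "lcm_pair (*) a x x' b"
  have "left_dvd (a * x') c" if c: "left_dvd x c" "left_dvd a c" for c
  proof -
    obtain s t where st: "c = a * s" "c = x * t" using c unfolding left_dvd_def by blast
    then obtain w where "s = x' * w" using l unfolding lcm_pair_def by metis
    thus ?thesis using st unfolding left_dvd_def by (metis mult.assoc)
  qed
  moreover have "left_dvd x (a * x')" "left_dvd a (a * x')"
    using assms unfolding left_dvd_def by metis+
  ultimately show "is_right_lcm x a (a * x')" unfolding is_right_lcm_def by blast
qed

lemma is_left_lcm_iff:
  assumes "b * x = x' * a"
  shows "is_left_lcm x a (x' * a) \<longleftrightarrow> lcm_pair (\<lambda>x y. y * x) (a :: 'a::gcd_monoid) x x' b"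
proof
  assume l: "is_left_lcm x a (x' * a)"
  have "\<exists>w. s = w * x'" if "s * a = t * x" for s t
  proof -
    have "right_dvd x (s * a)" "right_dvd a (s * a)" using that unfolding right_dvd_def by blast+
    then obtain w where "s * a = w * (x' * a)" using l unfolding is_left_lcm_def right_dvd_def by blast
    thus ?thesis using right_cancel by (auto simp: mult.assoc[symmetric])
  qed
  thus "lcm_pair (\<lambda>x y. y * x) a x x' b" using assms unfolding lcm_pair_def by metis
next
  assume l: "lcm_pair (\<lambda>x y. y * x) a x x' b"
  have "right_dvd (x' * a) c" if c: "right_dvd x c" "right_dvd a c" for c
  proof -
    obtain s t where st: "c = s * a" "c = t * x" using c unfolding right_dvd_def by blast
    then obtain w where "s = w * x'" using l unfolding lcm_pair_def by metis
    thus ?thesis using st unfolding right_dvd_def by (metis mult.assoc)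
  qed
  moreover have "right_dvd x (x' * a)" "right_dvd a (x' * a)"
    using assms unfolding right_dvd_def by metis+
  ultimately show "is_left_lcm x a (x' * a)" unfolding is_left_lcm_def by blast
qed

lemma R_step_iff:
  "R_step i x a b \<longleftrightarrow> length b = length a \<and> i < length a \<and> step i x (seq a) (seq b)"
proof (cases "length b = length a \<and> 1 \<le> i \<and> i < length a")
  case False
  thus ?thesis by (auto simp: R_step_def step_def)
next
  case True
  hence len: "length b = length a" "1 \<le> i" "i < length a" by auto
  define fr where "fr \<longleftrightarrow> (\<forall>k\<in>{1..length a} - {i - 1, i, i + 1}. entry b k = entry a k)"
  have seq: "seq a i = entry a i" "seq a (i + 1) = entry a (i + 1)"
    "2 \<le> i \<Longrightarrow> seq a (i - 1) = entry a (i - 1)" "2 \<le> i \<Longrightarrow> seq b (i - 1) = entry b (i - 1)"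
    "seq a 0 = 1" "seq b 0 = 1"
    using len by (auto simp: seq_def)
  have "step i x (seq a) (seq b) \<longleftrightarrow> fr \<and> (\<exists>x'. lcm_pair (mul (even i)) (entry a i) x x' (entry b i) \<and>
      (i = 1 \<longrightarrow> x' = 1) \<and> entry a (i + 1) = mul (even i) x (entry b (i + 1)) \<and>
      seq b (i - 1) = mul (even i) (seq a (i - 1)) x')"
    unfolding step_def seq_eq_upd_iff[OF len] seq(1,2) fr_def using len(2) by blast
  also have "\<dots> \<longleftrightarrow> R_step i x a b"
  proof -
    consider "i = 1" | "2 \<le> i" "even i" | "2 \<le> i" "odd i" using len(2) by linarith
    thus ?thesis
    proof cases
      \<comment> \<open>With \<open>x' = 1\<close> the lcm condition holds automatically, since
        \<open>x\<close> divides entry 1.\<close>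
      case 1
      thus ?thesis using len seq(5,6) unfolding R_step_def fr_def
        by (auto simp: lcm_pair_def mul_simps numeral_2_eq_2)
    next
      case 2
      have "i \<noteq> 1" using 2 by auto
      with 2 len show ?thesis unfolding R_step_def fr_def[symmetric] seq(3,4)[OF 2(1)]
        by (simp add: mul_simps) (metis is_right_lcm_iff lcm_pair_def)
    next
      case 3
      show ?thesis
      proof (cases "i = 1")
        case False
        with 3 len show ?thesis unfolding R_step_def fr_def[symmetric] seq(3,4)[OF 3(1)]
          by (simp add: mul_simps) (metis is_left_lcm_iff lcm_pair_def)
      qed (use 3 in simp)
    qed
  qed
  finally show ?thesis using len by simp
qed

context noetherian_3Ore
begin

text \<open>Values outside \<open>{1..length a}\<close> stay 1, for \<open>i = 1\<close> thanks to
  \<open>x' = 1\<close>, so a step never leaves the image of \<open>seq\<close>.\<close>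

lemma step_seq:
  assumes "step i (x :: 'a) (seq a) g" "i < length a"
  obtains b where "length b = length a" "seq b = g" "R_step i x a b"
proof -
  have "g k = 1" if "k = 0 \<or> length a < k" for k
    using assms(1)
  proof (rule stepE)
    fix x' b c
    assume "1 \<le> i" "i = 1 \<longrightarrow> x' = 1"
      "g = (seq a)(i - 1 := mul (even i) (seq a (i - 1)) x', i := b, i + 1 := c)"
    thus ?thesis using that assms(2) by (cases "i = 1") (auto simp: seq_def)
  qed
  then obtain b where "length b = length a" "seq b = g" by (rule seq_surj)
  with assms that show thesis by (simp add: R_step_iff)
qed

lemma reduces_iff:
  "reduces a b \<longleftrightarrow> length b = length a \<and> reduces_below (length a) (seq a) (seq (b :: 'a list))"
  unfolding reduces_def reduces_below_def R_step_iff by blast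

lemma reduces_seq:
  assumes "reduces\<^sup>*\<^sup>* a (b :: 'a list)"
  shows "length b = length a \<and> (reduces_below (length a))\<^sup>*\<^sup>* (seq a) (seq b)"
  using assms
proof (induction rule: rtranclp_induct)
  case (step b c)
  thus ?case by (auto simp: reduces_iff intro: rtranclp.rtrancl_into_rtrancl)
qed simp

lemma seq_reduces:
  assumes "(reduces_below (length a))\<^sup>*\<^sup>* (seq a) (g :: nat \<Rightarrow> 'a)"
  shows "\<exists>b. length b = length a \<and> seq b = g \<and> reduces\<^sup>*\<^sup>* a b"
  using assms
proof (induction rule: rtranclp_induct)
  case (step g h)
  then obtain b where b: "length b = length a" "seq b = g" "reduces\<^sup>*\<^sup>* a b" by blast
  obtain i x where "i < length b" "x \<noteq> 1" "step i x (seq b) h"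
    using step(2) b unfolding reduces_below_def by auto
  then obtain c where "length c = length b" "seq c = h" "reduces b c"
    using step_seq unfolding reduces_def by metis
  thus ?case using b by (metis rtranclp.rtrancl_into_rtrancl)
qed auto

lemma irreducible_seq: "(\<nexists>c. reduces a c) \<longleftrightarrow> irreducible_below (length a) (seq (a :: 'a list))"
  unfolding irreducible_below_iff reduces_iff
  by (metis step_seq reduces_below_def)

text \<open>The predicates under the two definite descriptions are equivalent, so the descriptions
  coincide.\<close>

lemma x_max_eq:
  assumes "1 \<le> i" "i < length a"
  shows "x_max i (a :: 'a list) = max_elt i (seq a)"
proof -
  have "(\<exists>b. R_step i x a b) \<longleftrightarrow> applicable i x (seq a)" for x
    using step_seq[OF _ assms(2)] applicable_imp_step step_imp_applicable R_step_iff by metis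
  moreover have "(if even i then left_dvd x z else right_dvd x z) \<longleftrightarrow> (\<exists>u. z = mul (even i) x u)"
    for x z :: 'a by (simp add: left_dvd_def right_dvd_def mul_def)
  ultimately show ?thesis unfolding x_max_def max_elt_def by simp
qed

lemma R_max_eq:
  assumes "1 \<le> i" "i < length a"
  shows "length (R_max i a) = length a \<and> seq (R_max i (a :: 'a list)) = max_step i (seq a)"
proof -
  obtain b where b: "length b = length a" "seq b = max_step i (seq a)" "R_step i (x_max i a) a b"
    using step_seq[OF step_max_step[OF assms(1)] assms(2)] x_max_eq[OF assms] by metis
  have "c = b" if "R_step i (x_max i a) a c" for c
  proof (rule seq_eqD)
    show "length c = length b" using that b(1) unfolding R_step_iff by simp
    show "seq c = seq b" using that b(3) step_unique unfolding R_step_iff by blast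
  qed
  with b(3) have "(THE c. R_step i (x_max i a) a c) = b" by (rule the_equality)
  hence "R_max i a = b" unfolding R_max_def using assms(2) by simp
  with b show ?thesis by simp
qed

lemma R_max_seq_foldl:
  assumes "set is \<subseteq> {1..<length a}"
  shows "length (R_max_seq is a) = length a \<and>
    seq (R_max_seq is (a :: 'a list)) = foldl (\<lambda>g i. max_step i g) (seq a) is"
  using assms
proof (induction "is" arbitrary: a)
  case (Cons i "is")
  thus ?case using R_max_eq[of i a] Cons.IH[of "R_max i a"] by (simp add: R_max_seq_def)
qed (simp add: R_max_seq_def)

end

theorem proposition6p7:
  fixes a :: "'a::gcd_monoid multifraction"
  assumes "noetherian TYPE('a)"
    and "three_Ore TYPE('a)"
  shows "red a = R_max_seq (U (length a)) a"
proof -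
  interpret noetherian_3Ore "TYPE('a)" using assms by unfold_locales
  define r where "r = R_max_seq (U (length a)) a"
  have r: "length r = length a" "seq r = foldl (\<lambda>g i. max_step i g) (seq a) (U (length a))"
    using R_max_seq_foldl[OF set_U] unfolding r_def by auto
  have "(reduces_below (length a))\<^sup>*\<^sup>* (seq a) (seq r)"
    unfolding r(2) by (rule reduces_below_foldl[OF set_U])
  \<comment> \<open>The reduction of functions lifts to lists, and \<open>seq\<close> is injective
    on lists of equal length, so the list reached is \<open>r\<close>.\<close>
  then obtain b where "length b = length a" "seq b = seq r" "reduces\<^sup>*\<^sup>* a b" using seq_reduces by blast
  hence ar: "reduces\<^sup>*\<^sup>* a r" using seq_eqD r(1) by metis
  have irr: "irreducible_below (length a) (seq r)" unfolding r(2) by (rule irreducible_below_U)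
  have "red a = r" unfolding red_def
  proof (rule the_equality)
    show "reduces\<^sup>*\<^sup>* a r \<and> (\<nexists>c. reduces r c)" using ar irr irreducible_seq r(1) by metis
    fix b assume b: "reduces\<^sup>*\<^sup>* a b \<and> (\<nexists>c. reduces b c)"
    hence "length b = length a" "irreducible_below (length a) (seq b)"
      using reduces_seq[of a b] irreducible_seq[of b] by auto
    moreover have "seq b = seq r"
      using normal_form_unique reduces_seq b ar irr calculation(2) by blast
    ultimately show "b = r" using seq_eqD r(1) by metis
  qed
  thus ?thesis unfolding r_def .
qed

end
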